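(* Let $F:\hat K\to K$ be an affine diffeomorphism between nondegenerate triangles in $\mathbb{R}^2$ with $F(\hat{\mathbf x}_i)=\mathbf x_i$ for $i=1,2,3$ and constant Jacobian matrix $J$. Let $\mathcal{F}^{\mathrm{div},\mathrm{div}}$ be the double contravariant Piola map, $N$ and $\hat N$ the (ordered, 24-component) vectors of degrees of freedom of the conforming Arnold--Winther element on $K$ and $\hat K$, and let $\mathcal{F}_*(N)$ be the componentwise push-forward, $\mathcal{F}_*(\ell)=\ell\circ\mathcal{F}^{\mathrm{div},\mathrm{div}}$. Then, as functionals on $\mathrm{AW}^{\mathrm{c}}(\hat K)$, $$\mathcal{F}_*(N)=\operatorname{diag}\big(\breve W,\ \breve W,\ \breve W,\ W^{1,1},\ W^{1,2},\ W^{1,3},\ \check W\big)\,\hat N$$ (block-diagonal matrix), where, for $k=1,2,3$, $$W^{1,k}=\frac{\|\hat{\mathbf e}_k\|}{\|\mathbf e_k\|}\begin{bmatrix}1&0&0&0\\ \alpha^k&\beta^k&0&0\\0&0&1&0\\0&0&\alpha^k&\beta^k\end{bmatrix},\qquad \tilde W=\begin{bmatrix}J_{11}^2&2J_{11}J_{12}&J_{12}^2\\ J_{11}J_{21}&J_{11}J_{22}+J_{12}J_{21}&J_{12}J_{22}\\ J_{21}^2&2J_{21}J_{22}&J_{22}^2\end{bmatrix},$$ $$\breve W=\frac{1}{(\det J)^2}\tilde W,\qquad \check W=\frac{1}{\det J}\tilde W.$$ Consequently, letting $P$ be the (blockwise) inverse of this block-diagonal matrix, $\hat N=P\,\mathcal{F}_*(N)$,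 and the nodal basis $\mathbf\Psi$ of $\mathrm{AW}^{\mathrm{c}}(K)$ (dual to $N$) is obtained from the nodal basis $\hat{\mathbf\Psi}$ of $\mathrm{AW}^{\mathrm{c}}(\hat K)$ (dual to $\hat N$) by $\mathbf\Psi=P^T\mathcal{F}^{\mathrm{div},\mathrm{div}}(\hat{\mathbf\Psi})$, with $\mathcal{F}^{\mathrm{div},\mathrm{div}}$ applied componentwise to the vector of basis functions.
   Context: Geometry: the triangle $K$ has vertices $\mathbf x_1,\mathbf x_2,\mathbf x_3$; edge $\mathbf e_k$ is the edge not containing vertex $k$, regarded as the column vector running from its lower-numbered vertex to its higher-numbered vertex (and also as a set). Its unit tangent is $\mathbf t=\mathbf t_k=\mathbf e_k/\|\mathbf e_k\|$ and its unit normal is $\mathbf n=\mathbf n_k=R\mathbf t_k$ with $R=\begin{bmatrix}0&1\\-1&0\end{bmatrix}$. Hatted quantities are defined in the same way on $\hat K$. $F$ is allowed to reverse orientation. Piola map: with $\mathbb S=\mathbb{R}^{2\times2}_{\mathrm{sym}}$, for $\hat\tau:\hat K\to\mathbb S$, $\mathcal{F}^{\mathrm{div},\mathrm{div}}(\hat\tau)=\frac{1}{(\det J)^2}J(\hat\tau\circ F^{-1})J^T$. Edge coefficients: for each $k$, $\begin{bmatrix}\alpha^k\\ \beta^k\end{bmatrix}=\frac{1}{\det J}\begin{bmatrix}\hat{\mathbf n}_k&\hat{\mathbf t}_k\end{bmatrix}^T J^TJ\,\hat{\mathbf t}_k$. Space: $\mathrm{AW}^{\mathrm{c}}(K)=\{\tau\in\mathcal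 P_3(K;\mathbb S): \mathrm{div}\,\tau\in\mathcal P_1(K;\mathbb{R}^2)\}$ (row-wise divergence), of dimension 24, where $\mathcal P_m$ denotes polynomials of degree at most $m$. Degrees of freedom: let $\mu_0=1$ and $\mu_1$ be a basis of the polynomials of degree at most 1 on the unit interval, transferred to each edge by pullback via the affine parametrization of the edge from its lower- to its higher-numbered vertex. Vertex values: $\ell^{k,i,j}(\tau)=\tau_{ij}(\mathbf x_k)$, $k=1,2,3$. Edge moments: $\ell^{\mathbf n,\mathbf s,i,k}(\tau)=\int_{\mathbf e_k}(\mathbf n\cdot\tau\mathbf s)\,\mu_i\,ds$ for $\mathbf s\in\{\mathbf n,\mathbf t\}$, $i\in\{0,1\}$. Cell moments: $\ell^{0,i,j}(\tau)=\int_K\tau_{ij}\,dx$. The vector of degrees of freedom is the block column vector $N=[N^{0,1},N^{0,2},N^{0,3},N^{1,1},N^{1,2},N^{1,3},N^{2}]^T$ with $N^{0,k}=[\ell^{k,1,1},\ell^{k,1,2},\ell^{k,2,2}]^T$, $N^{1,k}=[\ell^{\mathbf n,\mathbf n,0,k},\ell^{\mathbf n,\mathbf t,0,k},\ell^{\mathbf n,\mathbf n,1,k},\ell^{\mathbf n,\mathbf t,1,k}]^T$, $N^2=[\ell^{0,1,1},\ell^{0,1,2},\ell^{0,2,2}]^T$; these functionals are unisolvent on $\mathrm{AW}^{\mathrm{c}}(K)$. $\hat N$ is defined identically on $\hat K$. The nodal basis $\mathbf\Psi=(\Psi_j)$ is the basis with $\ell_i(\Psi_j)=\delta_{ij}$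 for the entries $\ell_i$ of $N$, and similarly for $\hat{\mathbf\Psi}$.
   Formalization: The cell block is taken as sgn(det J)·W̌ = W̃/|det J| instead of W̌ = W̃/det J; the printed block has the wrong sign when F reverses orientation (e.g. J = diag(−1,1)), and the two agree when det J > 0. *)

theory Defs
  imports "HOL-Analysis.Analysis" "HOL-Computational_Algebra.Polynomial"
begin

section \<open>Triangles\<close>

text \<open>A triangle is given by its numbered vertices \<open>x 1, x 2, x 3\<close>. As an element of the
  index type \<open>3\<close>, the numeral \<open>3\<close> equals \<open>0\<close>, so the library order on this type is not the vertex
  numbering; the lower- and higher-numbered ends of each edge are listed explicitly.\<close>

definition cell :: "(3 \<Rightarrow> real^2) \<Rightarrow> (real^2) set" where
  "cell x = convex hull {x 1, x 2, x 3}"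

definition nondegenerate :: "(3 \<Rightarrow> real^2) \<Rightarrow> bool" where
  "nondegenerate x \<longleftrightarrow> \<not> collinear {x 1, x 2, x 3}"

definition edge_lo :: "3 \<Rightarrow> 3" where
  "edge_lo k = (if k = 1 then 2 else 1)"

definition edge_hi :: "3 \<Rightarrow> 3" where
  "edge_hi k = (if k = 3 then 2 else 3)"

definition edge_vec :: "(3 \<Rightarrow> real^2) \<Rightarrow> 3 \<Rightarrow> real^2" where
  "edge_vec x k = x (edge_hi k) - x (edge_lo k)"

definition edge_tangent :: "(3 \<Rightarrow> real^2) \<Rightarrow> 3 \<Rightarrow> real^2" where
  "edge_tangent x k = (1 / norm (edge_vec x k)) *\<^sub>R edge_vec x k"

definition rot :: "real^2^2" where
  "rot = vector [vector [0, 1], vector [-1, 0]]"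

definition edge_normal :: "(3 \<Rightarrow> real^2) \<Rightarrow> 3 \<Rightarrow> real^2" where
  "edge_normal x k = rot *v edge_tangent x k"

section \<open>The conforming Arnold--Winther space\<close>

definition poly_deg_le :: "nat \<Rightarrow> (real^2 \<Rightarrow> real) \<Rightarrow> bool" where
  "poly_deg_le m f \<longleftrightarrow>
     (\<exists>a :: nat \<Rightarrow> nat \<Rightarrow> real. \<forall>y. f y = (\<Sum>i\<le>m. \<Sum>j\<le>m - i. a i j * (y $ 1) ^ i * (y $ 2) ^ j))"

definition row_div :: "(real^2 \<Rightarrow> real^2^2) \<Rightarrow> real^2 \<Rightarrow> real^2" where
  "row_div \<tau> y = (\<chi> i. \<Sum>j\<in>UNIV. frechet_derivative (\<lambda>z. \<tau> z $ i $ j) (at y) (axis j 1))"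

text \<open>A function on a triangle is represented by any total function with the right values on
  the triangle; values elsewhere are irrelevant. Hence membership asks for agreement on the
  triangle with a polynomial field \<open>p\<close>, and identities between such functions are stated on the
  triangle only.\<close>

definition AW :: "(3 \<Rightarrow> real^2) \<Rightarrow> (real^2 \<Rightarrow> real^2^2) set" where
  "AW x = {\<tau>. \<exists>p. (\<forall>y \<in> cell x. \<tau> y = p y)
              \<and> (\<forall>y. transpose (p y) = p y)
              \<and> (\<forall>i j. poly_deg_le 3 (\<lambda>y. p y $ i $ j))
              \<and> (\<forall>i. poly_deg_le 1 (\<lambda>y. row_div p y $ i))}"

section \<open>Degrees of freedom\<close>

text \<open>Index set of the 24 degrees of freedom: three vertex blocks of size 3, three edge blocks of
  size 4 and one cell block of size 3, in this order.\<close>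

type_synonym dof = "(3 \<times> 3) + ((3 \<times> 4) + 3)"

definition block_vec :: "(3 \<Rightarrow> real^3) \<Rightarrow> (3 \<Rightarrow> real^4) \<Rightarrow> real^3 \<Rightarrow> real^dof" where
  "block_vec u v w = (\<chi> r. case r of
       Inl (k, i) \<Rightarrow> u k $ i
     | Inr (Inl (k, i)) \<Rightarrow> v k $ i
     | Inr (Inr i) \<Rightarrow> w $ i)"

definition block_diag :: "(3 \<Rightarrow> real^3^3) \<Rightarrow> (3 \<Rightarrow> real^4^4) \<Rightarrow> real^3^3 \<Rightarrow> real^dof^dof" where
  "block_diag A B C = (\<chi> r c. case (r, c) of
       (Inl (k, i), Inl (l, j)) \<Rightarrow> if k = l then A k $ i $ j else 0
     | (Inr (Inl (k, i)), Inr (Inl (l, j))) \<Rightarrow> if k = l then B k $ i $ j else 0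
     | (Inr (Inr i), Inr (Inr j)) \<Rightarrow> C $ i $ j
     | _ \<Rightarrow> 0)"

text \<open>The polynomial \<open>\<mu>\<close> completes the constant 1 to a basis of the polynomials of degree at most
  1 on the unit interval.\<close>

definition completes_P1_basis :: "real poly \<Rightarrow> bool" where
  "completes_P1_basis \<mu> \<longleftrightarrow> degree \<mu> \<le> 1 \<and>
     (\<forall>p. degree p \<le> 1 \<longrightarrow> (\<exists>!c :: real \<times> real. p = smult (fst c) 1 + smult (snd c) \<mu>))"

text \<open>The arc-length integral of \<open>(n \<bullet> \<tau> s) m\<close> over the edge \<open>k\<close>, written in the affine
  parametrization from the lower- to the higher-numbered vertex; \<open>m\<close> is a function of the
  parameter.\<close>

definition edge_moment ::
  "(3 \<Rightarrow> real^2) \<Rightarrow> 3 \<Rightarrow> real^2 \<Rightarrow> real poly \<Rightarrow> (real^2 \<Rightarrow> real^2^2) \<Rightarrow> real" where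
  "edge_moment x k s m \<tau> = norm (edge_vec x k) *
     integral {0..1} (\<lambda>r. (edge_normal x k \<bullet> (\<tau> (linepath (x (edge_lo k)) (x (edge_hi k)) r) *v s))
                            * poly m r)"

definition vertex_dofs :: "(3 \<Rightarrow> real^2) \<Rightarrow> 3 \<Rightarrow> (real^2 \<Rightarrow> real^2^2) \<Rightarrow> real^3" where
  "vertex_dofs x k \<tau> = vector [\<tau> (x k) $ 1 $ 1, \<tau> (x k) $ 1 $ 2, \<tau> (x k) $ 2 $ 2]"

definition edge_dofs ::
  "(3 \<Rightarrow> real^2) \<Rightarrow> real poly \<Rightarrow> 3 \<Rightarrow> (real^2 \<Rightarrow> real^2^2) \<Rightarrow> real^4" where
  "edge_dofs x \<mu> k \<tau> = vector
     [edge_moment x k (edge_normal x k) 1 \<tau>, edge_moment x k (edge_tangent x k) 1 \<tau>,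
      edge_moment x k (edge_normal x k) \<mu> \<tau>, edge_moment x k (edge_tangent x k) \<mu> \<tau>]"

definition cell_dofs :: "(3 \<Rightarrow> real^2) \<Rightarrow> (real^2 \<Rightarrow> real^2^2) \<Rightarrow> real^3" where
  "cell_dofs x \<tau> = vector
     [integral (cell x) (\<lambda>y. \<tau> y $ 1 $ 1),
      integral (cell x) (\<lambda>y. \<tau> y $ 1 $ 2),
      integral (cell x) (\<lambda>y. \<tau> y $ 2 $ 2)]"

definition dofs :: "(3 \<Rightarrow> real^2) \<Rightarrow> real poly \<Rightarrow> (real^2 \<Rightarrow> real^2^2) \<Rightarrow> real^dof" where
  "dofs x \<mu> \<tau> =
     block_vec (\<lambda>k. vertex_dofs x k \<tau>) (\<lambda>k. edge_dofs x \<mu> k \<tau>) (cell_dofs x \<tau>)"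

definition nodal_basis ::
  "(3 \<Rightarrow> real^2) \<Rightarrow> real poly \<Rightarrow> (dof \<Rightarrow> real^2 \<Rightarrow> real^2^2) \<Rightarrow> bool" where
  "nodal_basis x \<mu> \<Psi> \<longleftrightarrow>
     (\<forall>j. \<Psi> j \<in> AW x) \<and>
     (\<forall>\<tau> \<in> AW x. \<exists>!c :: real^dof. \<forall>y \<in> cell x. \<tau> y = (\<Sum>j\<in>UNIV. (c $ j) *\<^sub>R \<Psi> j y)) \<and>
     (\<forall>i j. dofs x \<mu> (\<Psi> j) $ i = (if i = j then 1 else 0))"

section \<open>Piola map and transformation matrices\<close>

text \<open>Here \<open>A\<close> is the reference cell, so that \<open>inv_into A F\<close> is the inverse of the map \<open>F\<close> defined
  on \<open>A\<close>.\<close>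

definition piola ::
  "(real^2) set \<Rightarrow> (real^2 \<Rightarrow> real^2) \<Rightarrow> real^2^2 \<Rightarrow> (real^2 \<Rightarrow> real^2^2) \<Rightarrow> real^2 \<Rightarrow> real^2^2" where
  "piola A F J \<tau> y = (1 / (det J)\<^sup>2) *\<^sub>R (J ** \<tau> (inv_into A F y) ** transpose J)"

text \<open>Components 1 and 2 are \<open>\<alpha>\<^sup>k\<close> and \<open>\<beta>\<^sup>k\<close>. The matrix with rows \<open>n, t\<close> is the transpose of the
  matrix with columns \<open>n, t\<close>.\<close>

definition edge_coeffs :: "(3 \<Rightarrow> real^2) \<Rightarrow> real^2^2 \<Rightarrow> 3 \<Rightarrow> real^2" where
  "edge_coeffs xh J k = (1 / det J) *\<^sub>R
     (((vector [edge_normal xh k, edge_tangent xh k] :: real^2^2) ** transpose J ** J)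
        *v edge_tangent xh k)"

definition W_edge :: "(3 \<Rightarrow> real^2) \<Rightarrow> (3 \<Rightarrow> real^2) \<Rightarrow> real^2^2 \<Rightarrow> 3 \<Rightarrow> real^4^4" where
  "W_edge xh x J k =
     (let \<alpha> = edge_coeffs xh J k $ 1; \<beta> = edge_coeffs xh J k $ 2 in
      (norm (edge_vec xh k) / norm (edge_vec x k)) *\<^sub>R vector
        [vector [1, 0, 0, 0],
         vector [\<alpha>, \<beta>, 0, 0],
         vector [0, 0, 1, 0],
         vector [0, 0, \<alpha>, \<beta>]])"

definition W_tilde :: "real^2^2 \<Rightarrow> real^3^3" where
  "W_tilde J = vector
     [vector [(J$1$1)\<^sup>2, 2 * J$1$1 * J$1$2, (J$1$2)\<^sup>2],
      vector [J$1$1 * J$2$1, J$1$1 * J$2$2 + J$1$2 * J$2$1, J$1$2 * J$2$2],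
      vector [(J$2$1)\<^sup>2, 2 * J$2$1 * J$2$2, (J$2$2)\<^sup>2]]"

definition W_breve :: "real^2^2 \<Rightarrow> real^3^3" where
  "W_breve J = (1 / (det J)\<^sup>2) *\<^sub>R W_tilde J"

text \<open>The cell block of the transformation matrix is \<open>W_tilde J\<close> divided by \<open>\<bar>det J\<bar>\<close>: the Piola
  map contributes \<open>1 / (det J)\<^sup>2\<close> and the change of variables in the cell integral contributes
  \<open>\<bar>det J\<bar>\<close>. So \<open>W_check\<close> itself is the cell block when \<open>F\<close> preserves orientation, and
  \<open>sgn (det J) *\<^sub>R W_check J\<close> is the cell block in general.\<close>

definition W_check :: "real^2^2 \<Rightarrow> real^3^3" where
  "W_check J = (1 / det J) *\<^sub>R W_tilde J"

end

theory Submission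
  imports Defs
begin

text \<open>The Piola map acts on values by \<open>M \<mapsto> J M J\<^sup>T / (det J)\<^sup>2\<close>, and each block of degrees of freedom sees
  this congruence through a different pairing.

  Vertex values and cell integrals see the congruence itself, which in the coordinates
  \<open>(M\<^sub>1\<^sub>1, M\<^sub>1\<^sub>2, M\<^sub>2\<^sub>2)\<close> of a symmetric matrix is multiplication by \<open>W_breve\<close> (\<open>sym_vec_piola_mat\<close>). For
  cell integrals the change of variables brings in \<open>\<bar>det J\<bar>\<close> (\<open>cell_dofs_piola\<close>).

  Edge moments see \<open>n \<bullet> J M J\<^sup>T s\<close>, so only \<open>J\<^sup>T n\<close> and \<open>J\<^sup>T s\<close> matter. Edges are mapped to edges, and
  \<open>J\<^sup>T R J = (det J) R\<close> in the plane, so \<open>J\<^sup>T n\<close> is a multiple of the reference normal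
  (\<open>normal_pullback\<close>), while \<open>J\<^sup>T t\<close> expands in the reference frame with the coefficients \<open>\<alpha>\<close> and
  \<open>\<beta>\<close> (\<open>tangent_pullback\<close>). This gives the lower-triangular edge blocks (\<open>edge_moment_piola\<close>).

  The Piola map preserves the space because affine substitution preserves degrees and the row-wise
  divergence commutes with it up to a constant matrix (\<open>row_div_piola_mat\<close>).

  The blocks are invertible: \<open>W_tilde\<close> is multiplicative in \<open>J\<close>, and \<open>\<beta>\<close> is nonzero. The formula for
  the nodal basis is then duality. The fields on its right-hand side lie in the space, and by linearity
  of the degrees of freedom (\<open>dofs_sum\<close>) their degrees of freedom are the columns of \<open>D P = 1\<close>. Such
  fields are the nodal basis (\<open>nodal_basis_unique\<close>).\<close>

section \<open>Polynomials of bounded degree\<close>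

lemma poly_deg_le_monomial:
  assumes "i + j \<le> m"
  shows "poly_deg_le m (\<lambda>y. (y $ 1) ^ i * (y $ 2) ^ j)"
proof -
  have "(\<Sum>i'\<le>m. \<Sum>j'\<le>m - i'. (if i' = i \<and> j' = j then 1 else 0) * u ^ i' * v ^ j') = u ^ i * v ^ j"
    for u v :: real
  proof -
    have "(\<Sum>i'\<le>m. \<Sum>j'\<le>m - i'. (if i' = i \<and> j' = j then 1 else 0) * u ^ i' * v ^ j')
        = (\<Sum>i'\<le>m. if i' = i then \<Sum>j'\<le>m - i'. if j' = j then u ^ i' * v ^ j' else 0 else 0)"
      by (intro sum.cong refl) (simp add: if_distrib[of "\<lambda>z. z * _"] cong: if_cong)
    also have "\<dots> = u ^ i * v ^ j"
      using assms by (simp add: sum.delta)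
    finally show ?thesis .
  qed
  then show ?thesis
    unfolding poly_deg_le_def by (intro exI[of _ "\<lambda>i' j'. if i' = i \<and> j' = j then 1 else 0"]) simp
qed

lemma poly_deg_le_add:
  assumes "poly_deg_le m f" "poly_deg_le m g"
  shows "poly_deg_le m (\<lambda>y. f y + g y)"
proof -
  obtain a b where "\<And>y. f y = (\<Sum>i\<le>m. \<Sum>j\<le>m - i. a i j * (y $ 1) ^ i * (y $ 2) ^ j)"
      "\<And>y. g y = (\<Sum>i\<le>m. \<Sum>j\<le>m - i. b i j * (y $ 1) ^ i * (y $ 2) ^ j)"
    using assms unfolding poly_deg_le_def by blast
  then show ?thesis
    unfolding poly_deg_le_def
    by (intro exI[of _ "\<lambda>i j. a i j + b i j"]) (simp add: distrib_right sum.distrib)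
qed

lemma poly_deg_le_cmul:
  assumes "poly_deg_le m f"
  shows "poly_deg_le m (\<lambda>y. c * f y)"
proof -
  obtain a where "\<And>y. f y = (\<Sum>i\<le>m. \<Sum>j\<le>m - i. a i j * (y $ 1) ^ i * (y $ 2) ^ j)"
    using assms unfolding poly_deg_le_def by blast
  then show ?thesis
    unfolding poly_deg_le_def
    by (intro exI[of _ "\<lambda>i j. c * a i j"]) (simp add: sum_distrib_left mult.assoc)
qed

lemma poly_deg_le_const: "poly_deg_le m (\<lambda>y. c)"
  using poly_deg_le_cmul[OF poly_deg_le_monomial[of 0 0 m], of c] by simp

lemma poly_deg_le_sum:
  assumes "\<And>i. i \<in> S \<Longrightarrow> poly_deg_le m (f i)"
  shows "poly_deg_le m (\<lambda>y. \<Sum>i\<in>S. f i y)"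
  using assms
  by (induction S rule: infinite_finite_induct) (auto intro: poly_deg_le_const poly_deg_le_add)

lemma poly_deg_le_mult:
  assumes "poly_deg_le m f" "poly_deg_le n g"
  shows "poly_deg_le (m + n) (\<lambda>y. f y * g y)"
proof -
  obtain a b where ab: "\<And>y. f y = (\<Sum>i\<le>m. \<Sum>j\<le>m - i. a i j * (y $ 1) ^ i * (y $ 2) ^ j)"
      "\<And>y. g y = (\<Sum>i\<le>n. \<Sum>j\<le>n - i. b i j * (y $ 1) ^ i * (y $ 2) ^ j)"
    using assms unfolding poly_deg_le_def by blast
  have "(\<lambda>y. f y * g y) = (\<lambda>y. \<Sum>i\<le>m. \<Sum>k\<le>n. \<Sum>j\<le>m - i. \<Sum>l\<le>n - k.
      (a i j * b k l) * ((y $ 1) ^ (i + k) * (y $ 2) ^ (j + l)))"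
    unfolding ab sum_product by (simp add: power_add mult_ac)
  then show ?thesis
    by (auto intro!: poly_deg_le_sum poly_deg_le_cmul poly_deg_le_monomial)
qed

lemma poly_deg_le_mono:
  assumes "poly_deg_le m f" "m \<le> n"
  shows "poly_deg_le n f"
  using poly_deg_le_mult[OF assms(1) poly_deg_le_const[of "n - m" 1]] assms(2) by simp

lemma poly_deg_le_power:
  assumes "poly_deg_le m f"
  shows "poly_deg_le (m * i) (\<lambda>y. f y ^ i)"
proof (induction i)
  case (Suc i)
  then show ?case using poly_deg_le_mult[OF assms Suc] by simp
qed (simp add: poly_deg_le_const)

lemma poly_deg_le_affine:
  "poly_deg_le 1 (\<lambda>y. ((A :: real^2^2) *v y + c) $ i)"
proof -
  have *: "(\<lambda>y. (A *v y + c) $ i)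
      = (\<lambda>y. A $ i $ 1 * (y $ 1 ^ 1 * y $ 2 ^ 0) + A $ i $ 2 * (y $ 1 ^ 0 * y $ 2 ^ 1) + c $ i)"
    by (simp add: matrix_vector_mult_def sum_2)
  show ?thesis
    unfolding * by (intro poly_deg_le_add poly_deg_le_cmul poly_deg_le_monomial poly_deg_le_const) auto
qed

text \<open>Substituting an affine map into a monomial of degree \<open>i + j\<close> gives a product of \<open>i + j\<close>
  affine factors. This is why the Piola map preserves both degree bounds in the definition of
  the Arnold--Winther space.\<close>

lemma poly_deg_le_compose_affine:
  assumes "poly_deg_le m f"
  shows "poly_deg_le m (\<lambda>y. f ((A :: real^2^2) *v y + c))"
proof -
  obtain a where a: "\<And>y. f y = (\<Sum>i\<le>m. \<Sum>j\<le>m - i. a i j * (y $ 1) ^ i * (y $ 2) ^ j)"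
    using assms unfolding poly_deg_le_def by blast
  have "poly_deg_le m (\<lambda>y. a i j * (((A *v y + c) $ 1) ^ i * ((A *v y + c) $ 2) ^ j))"
    if "i + j \<le> m" for i j
    using poly_deg_le_mult[OF poly_deg_le_power[OF poly_deg_le_affine[of A c 1], of i]
        poly_deg_le_power[OF poly_deg_le_affine[of A c 2], of j]] that
    by (intro poly_deg_le_cmul) (auto intro: poly_deg_le_mono)
  then show ?thesis
    unfolding a mult.assoc by (auto intro!: poly_deg_le_sum)
qed

lemma poly_deg_le_differentiable:
  assumes "poly_deg_le m f"
  shows "f differentiable (at y)"
proof -
  obtain a where a: "f = (\<lambda>y. \<Sum>i\<le>m. \<Sum>j\<le>m - i. a i j * (y $ 1) ^ i * (y $ 2) ^ j)"
    using assms unfolding poly_deg_le_def by blast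
  have "(\<lambda>y :: real^2. y $ i) differentiable (at y)" for i
    by (intro bounded_linear_imp_differentiable bounded_linear_vec_nth)
  then show ?thesis
    unfolding a by (intro differentiable_sum differentiable_mult differentiable_power differentiable_const) auto
qed

section \<open>Fields in the Arnold--Winther space\<close>

definition AW_poly :: "(real^2 \<Rightarrow> real^2^2) \<Rightarrow> bool" where
  "AW_poly p \<longleftrightarrow> (\<forall>y. transpose (p y) = p y)
     \<and> (\<forall>i j. poly_deg_le 3 (\<lambda>y. p y $ i $ j))
     \<and> (\<forall>i. poly_deg_le 1 (\<lambda>y. row_div p y $ i))"

lemma AW_iff: "\<tau> \<in> AW x \<longleftrightarrow> (\<exists>p. AW_poly p \<and> (\<forall>y\<in>cell x. \<tau> y = p y))"
  unfolding AW_def AW_poly_def by blast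

lemma AW_poly_entry_differentiable:
  "AW_poly p \<Longrightarrow> (\<lambda>z. p z $ i $ j) differentiable (at y)"
  unfolding AW_poly_def by (auto intro: poly_deg_le_differentiable)

lemma AW_poly_sum:
  assumes "\<And>s. s \<in> S \<Longrightarrow> AW_poly (p s)"
  shows "AW_poly (\<lambda>y. \<Sum>s\<in>S. c s *\<^sub>R p s y)"
proof -
  have deriv: "((\<lambda>z. (\<Sum>s\<in>S. c s *\<^sub>R p s z) $ i $ j) has_derivative
      (\<lambda>h. \<Sum>s\<in>S. c s * frechet_derivative (\<lambda>z. p s z $ i $ j) (at y) h)) (at y)" for i j y
    using AW_poly_entry_differentiable[OF assms]
    by (auto intro!: derivative_eq_intros simp flip: frechet_derivative_works)
  have "row_div (\<lambda>y. \<Sum>s\<in>S. c s *\<^sub>R p s y) y $ i = (\<Sum>s\<in>S. c s * row_div (p s) y $ i)" for y i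
    unfolding row_div_def frechet_derivative_at[OF deriv, symmetric]
    by (simp add: sum_2 sum.distrib distrib_left)
  then show ?thesis
    using assms unfolding AW_poly_def
    by (auto simp: vec_eq_iff transpose_def intro!: poly_deg_le_sum poly_deg_le_cmul)
qed

lemma AW_sum:
  assumes "\<And>s. s \<in> S \<Longrightarrow> \<phi> s \<in> AW x"
  shows "(\<lambda>y. \<Sum>s\<in>S. c s *\<^sub>R \<phi> s y) \<in> AW x"
proof -
  from assms obtain p where "\<And>s. s \<in> S \<Longrightarrow> AW_poly (p s) \<and> (\<forall>y\<in>cell x. \<phi> s y = p s y)"
    unfolding AW_iff by metis
  then show ?thesis
    unfolding AW_iff
    by (intro exI[of _ "\<lambda>y. \<Sum>s\<in>S. c s *\<^sub>R p s y"]) (auto intro: AW_poly_sum)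
qed

lemma AW_continuous_on:
  assumes "\<tau> \<in> AW x"
  shows "continuous_on (cell x) \<tau>"
proof -
  obtain p where p: "AW_poly p" "\<And>y. y \<in> cell x \<Longrightarrow> \<tau> y = p y"
    using assms unfolding AW_iff by blast
  have "continuous_on (cell x) (\<lambda>y. \<chi> i. \<chi> j. p y $ i $ j)"
    using AW_poly_entry_differentiable[OF p(1)]
    by (intro continuous_on_vec_lambda)
       (auto intro!: continuous_at_imp_continuous_on differentiable_imp_continuous_within)
  then show ?thesis
    using p(2) by (simp cong: continuous_on_cong)
qed

lemma AW_symmetric: "\<tau> \<in> AW x \<Longrightarrow> y \<in> cell x \<Longrightarrow> \<tau> y $ 2 $ 1 = \<tau> y $ 1 $ 2"
  unfolding AW_iff AW_poly_def by (auto simp: vec_eq_iff transpose_def)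

lemma compact_cell: "compact (cell x)"
  unfolding cell_def by (intro compact_convex_hull) auto

lemma vertex_in_cell: "x k \<in> cell x"
proof -
  have "k \<in> {1, 2, 3}" using UNIV_3 by blast
  then show ?thesis unfolding cell_def by (intro hull_inc) auto
qed

lemma edge_point_in_cell:
  assumes "r \<in> {0..1}"
  shows "linepath (x i) (x j) r \<in> cell x"
proof -
  have "closed_segment (x i) (x j) \<subseteq> cell x"
    using vertex_in_cell closed_segment_subset unfolding cell_def by (metis convex_convex_hull)
  then show ?thesis
    using assms by (force simp: linepath_in_path)
qed

text \<open>The coordinates of a symmetric matrix in which \<open>W_tilde\<close> is written. Vertex values and cell
  moments are \<open>sym_vec\<close> of a point value and of an integral, so that one matrix identity serves both.\<close>

definition sym_vec :: "real^2^2 \<Rightarrow> real^3" where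
  "sym_vec M = vector [M $ 1 $ 1, M $ 1 $ 2, M $ 2 $ 2]"

lemma linear_sym_vec: "linear sym_vec"
  by (intro linearI) (simp_all add: sym_vec_def vec_eq_iff forall_3)

lemma linear_inner_matrix_vector: "linear (\<lambda>M :: real^2^2. n \<bullet> (M *v s))"
  by (intro linearI) (simp_all add: matrix_vector_mult_add_rdistrib inner_add_right scaleR_matrix_vector_assoc[symmetric])

lemma vertex_dofs_sym_vec: "vertex_dofs x k \<tau> = sym_vec (\<tau> (x k))"
  by (simp add: vertex_dofs_def sym_vec_def)

text \<open>Fields in the space agree with polynomials on the triangle, hence are continuous there. This is
  what makes every integral below exist and so depend linearly on the field; for arbitrary fields
  the degrees of freedom would not be linear.\<close>

lemma continuous_on_linear_AW:
  fixes f :: "real^2^2 \<Rightarrow> 'a :: real_normed_vector"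
  assumes "\<tau> \<in> AW x" "linear f"
  shows "continuous_on (cell x) (\<lambda>y. f (\<tau> y))"
  using continuous_on_compose[OF AW_continuous_on[OF assms(1)] linear_continuous_on[of f]] assms(2)
  by (simp add: linear_conv_bounded_linear o_def)

lemma sym_vec_integrable:
  "\<tau> \<in> AW x \<Longrightarrow> (\<lambda>y. sym_vec (\<tau> y)) absolutely_integrable_on (cell x)"
  using integrable_completion[of "\<lambda>y. indicator (cell x) y *\<^sub>R sym_vec (\<tau> y)" lborel]
    borel_integrable_compact[OF compact_cell continuous_on_linear_AW[OF _ linear_sym_vec], of \<tau> x]
  by (simp add: set_integrable_def integrable_completion borel_measurable_integrable)

lemma cell_dofs_sym_vec:
  assumes "\<tau> \<in> AW x"
  shows "cell_dofs x \<tau> = integral (cell x) (\<lambda>y. sym_vec (\<tau> y))"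
proof -
  have int: "(\<lambda>y. sym_vec (\<tau> y)) integrable_on (cell x)"
    using sym_vec_integrable[OF assms] by (rule set_lebesgue_integral_eq_integral(1))
  have "integral (cell x) (\<lambda>y. sym_vec (\<tau> y)) $ i = integral (cell x) (\<lambda>y. sym_vec (\<tau> y) $ i)" for i
    using integral_linear[OF int bounded_linear_vec_nth[of i]] by (simp add: o_def)
  then show ?thesis
    by (simp add: vec_eq_iff forall_3 cell_dofs_def) (simp add: sym_vec_def)
qed

lemma edge_moment_integrable:
  assumes "\<tau> \<in> AW x"
  shows "(\<lambda>r. (n \<bullet> (\<tau> (linepath (x i) (x j) r) *v s)) * poly m r) integrable_on {0..1}"
proof (rule integrable_continuous_interval)
  have "continuous_on {0..1} (\<lambda>r. n \<bullet> (\<tau> (linepath (x i) (x j) r) *v s))"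
    by (rule continuous_on_compose2[OF continuous_on_linear_AW[OF assms linear_inner_matrix_vector]])
       (auto intro!: continuous_intros continuous_on_linepath edge_point_in_cell simp del: atLeastAtMost_iff)
  then show "continuous_on {0..1} (\<lambda>r. (n \<bullet> (\<tau> (linepath (x i) (x j) r) *v s)) * poly m r)"
    by (rule continuous_on_mult) (intro continuous_intros)
qed

lemma edge_moment_sum:
  assumes "finite S" "\<And>i. i \<in> S \<Longrightarrow> \<phi> i \<in> AW x"
  shows "edge_moment x k s m (\<lambda>y. \<Sum>i\<in>S. c i *\<^sub>R \<phi> i y) = (\<Sum>i\<in>S. c i * edge_moment x k s m (\<phi> i))"
proof -
  let ?n = "edge_normal x k" and ?\<gamma> = "linepath (x (edge_lo k)) (x (edge_hi k))"
  note lin = linear_inner_matrix_vector[of ?n s]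
  have "integral {0..1} (\<lambda>r. (?n \<bullet> ((\<Sum>i\<in>S. c i *\<^sub>R \<phi> i (?\<gamma> r)) *v s)) * poly m r)
      = integral {0..1} (\<lambda>r. \<Sum>i\<in>S. c i * ((?n \<bullet> (\<phi> i (?\<gamma> r) *v s)) * poly m r))"
    by (simp add: linear_sum[OF lin] linear_scale[OF lin] sum_distrib_right mult.assoc)
  also have "\<dots> = (\<Sum>i\<in>S. c i * integral {0..1} (\<lambda>r. (?n \<bullet> (\<phi> i (?\<gamma> r) *v s)) * poly m r))"
    using assms by (subst integral_sum) (auto intro!: integrable_on_mult_right edge_moment_integrable)
  finally show ?thesis
    by (simp add: edge_moment_def sum_distrib_left mult.left_commute)
qed

lemma edge_moment_lincomb:
  assumes "\<tau> \<in> AW x"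
  shows "edge_moment x k (a *\<^sub>R s + b *\<^sub>R s') m \<tau> = a * edge_moment x k s m \<tau> + b * edge_moment x k s' m \<tau>"
proof -
  let ?n = "edge_normal x k" and ?\<gamma> = "linepath (x (edge_lo k)) (x (edge_hi k))"
  have "integral {0..1} (\<lambda>r. (?n \<bullet> (\<tau> (?\<gamma> r) *v (a *\<^sub>R s + b *\<^sub>R s'))) * poly m r)
      = integral {0..1} (\<lambda>r. a * ((?n \<bullet> (\<tau> (?\<gamma> r) *v s)) * poly m r) + b * ((?n \<bullet> (\<tau> (?\<gamma> r) *v s')) * poly m r))"
    by (simp add: matrix_vector_right_distrib matrix_vector_mult_scaleR inner_add_right algebra_simps)
  also have "\<dots> = a * integral {0..1} (\<lambda>r. (?n \<bullet> (\<tau> (?\<gamma> r) *v s)) * poly m r)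
      + b * integral {0..1} (\<lambda>r. (?n \<bullet> (\<tau> (?\<gamma> r) *v s')) * poly m r)"
    by (subst integral_add) (auto intro!: integrable_on_mult_right edge_moment_integrable assms)
  finally show ?thesis
    by (simp add: edge_moment_def algebra_simps)
qed

lemma cell_dofs_sum:
  assumes "finite S" "\<And>i. i \<in> S \<Longrightarrow> \<phi> i \<in> AW x"
  shows "cell_dofs x (\<lambda>y. \<Sum>i\<in>S. c i *\<^sub>R \<phi> i y) = (\<Sum>i\<in>S. c i *\<^sub>R cell_dofs x (\<phi> i))"
proof -
  have int: "(\<lambda>y. sym_vec (\<phi> i y)) integrable_on (cell x)" if "i \<in> S" for i
    using sym_vec_integrable[OF assms(2)[OF that]] by (rule set_lebesgue_integral_eq_integral(1))
  have "cell_dofs x (\<lambda>y. \<Sum>i\<in>S. c i *\<^sub>R \<phi> i y)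
      = integral (cell x) (\<lambda>y. \<Sum>i\<in>S. c i *\<^sub>R sym_vec (\<phi> i y))"
    by (simp add: cell_dofs_sym_vec[OF AW_sum[OF assms(2)]]
        linear_sum[OF linear_sym_vec] linear_scale[OF linear_sym_vec])
  also have "\<dots> = (\<Sum>i\<in>S. c i *\<^sub>R integral (cell x) (\<lambda>y. sym_vec (\<phi> i y)))"
    using assms(1) int by (subst integral_sum) (auto intro!: integrable_cmul)
  finally show ?thesis
    using assms(2) by (simp add: cell_dofs_sym_vec)
qed

section \<open>Block vectors and block-diagonal matrices\<close>

lemma sum_dof:
  "(\<Sum>r\<in>(UNIV :: dof set). f r) =
     (\<Sum>k\<in>UNIV. \<Sum>i\<in>UNIV. f (Inl (k, i))) + (\<Sum>k\<in>UNIV. \<Sum>i\<in>UNIV. f (Inr (Inl (k, i))))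
     + (\<Sum>i\<in>UNIV. f (Inr (Inr i)))"
  by (simp add: UNIV_Plus_UNIV[symmetric] sum.Plus UNIV_Times_UNIV[symmetric] sum.cartesian_product
        add.assoc del: UNIV_Plus_UNIV UNIV_Times_UNIV)

lemma all_dof: "(\<forall>r :: dof. Q r) \<longleftrightarrow>
   (\<forall>k i. Q (Inl (k, i))) \<and> (\<forall>k i. Q (Inr (Inl (k, i)))) \<and> (\<forall>i. Q (Inr (Inr i)))"
  by (metis sum.exhaust surj_pair)

lemma sum_diag_block:
  fixes f g :: "'k :: finite \<Rightarrow> 'i :: finite \<Rightarrow> real"
  shows "(\<Sum>l\<in>UNIV. \<Sum>j\<in>UNIV. (if k = l then f l j else 0) * g l j) = (\<Sum>j\<in>UNIV. f k j * g k j)"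
proof -
  have "(\<Sum>j\<in>UNIV. (if k = l then f l j else 0) * g l j) = (if k = l then \<Sum>j\<in>UNIV. f l j * g l j else 0)" for l
    by simp
  then show ?thesis by simp
qed

lemma block_diag_mult_block_vec:
  "block_diag A B C *v block_vec u v w = block_vec (\<lambda>k. A k *v u k) (\<lambda>k. B k *v v k) (C *v w)"
  by (simp add: vec_eq_iff all_dof matrix_vector_mult_def sum_dof block_diag_def block_vec_def sum_diag_block)

lemma block_diag_mult:
  "block_diag A B C ** block_diag A' B' C' = block_diag (\<lambda>k. A k ** A' k) (\<lambda>k. B k ** B' k) (C ** C')"
  by (auto simp add: vec_eq_iff all_dof matrix_matrix_mult_def sum_dof block_diag_def sum_diag_block)

lemma block_diag_mat_1: "block_diag (\<lambda>k. mat 1) (\<lambda>k. mat 1) (mat 1) = mat 1"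
  by (auto simp add: vec_eq_iff all_dof block_diag_def mat_def)

section \<open>Linearity of the degrees of freedom and uniqueness of the nodal basis\<close>

lemma sum_block_vec:
  "(\<Sum>s\<in>S. c s *\<^sub>R block_vec (u s) (v s) (w s))
     = block_vec (\<lambda>k. \<Sum>s\<in>S. c s *\<^sub>R u s k) (\<lambda>k. \<Sum>s\<in>S. c s *\<^sub>R v s k) (\<Sum>s\<in>S. c s *\<^sub>R w s)"
  by (simp add: vec_eq_iff all_dof block_vec_def)

lemma dofs_sum:
  assumes "finite S" "\<And>s. s \<in> S \<Longrightarrow> \<phi> s \<in> AW x"
  shows "dofs x \<mu> (\<lambda>y. \<Sum>s\<in>S. c s *\<^sub>R \<phi> s y) = (\<Sum>s\<in>S. c s *\<^sub>R dofs x \<mu> (\<phi> s))"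
proof -
  have "vertex_dofs x k (\<lambda>y. \<Sum>s\<in>S. c s *\<^sub>R \<phi> s y) = (\<Sum>s\<in>S. c s *\<^sub>R vertex_dofs x k (\<phi> s))" for k
    by (simp add: vertex_dofs_sym_vec linear_sum[OF linear_sym_vec] linear_scale[OF linear_sym_vec])
  moreover have "edge_dofs x \<mu> k (\<lambda>y. \<Sum>s\<in>S. c s *\<^sub>R \<phi> s y) = (\<Sum>s\<in>S. c s *\<^sub>R edge_dofs x \<mu> k (\<phi> s))" for k
  proof -
    have "edge_moment x k t m (\<lambda>y. \<Sum>s\<in>S. c s *\<^sub>R \<phi> s y) = (\<Sum>s\<in>S. c s * edge_moment x k t m (\<phi> s))" for t m
      using assms by (rule edge_moment_sum)
    then show ?thesis
      by (simp add: edge_dofs_def vec_eq_iff forall_4 vector_def)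
  qed
  moreover note cell_dofs_sum[OF assms]
  ultimately show ?thesis
    unfolding dofs_def sum_block_vec by simp
qed

lemma dofs_cong:
  assumes "\<And>y. y \<in> cell x \<Longrightarrow> \<tau> y = \<tau>' y"
  shows "dofs x \<mu> \<tau> = dofs x \<mu> \<tau>'"
proof -
  have "edge_moment x k s m \<tau> = edge_moment x k s m \<tau>'" for k s m
    unfolding edge_moment_def using assms edge_point_in_cell by (auto intro!: arg_cong2[of _ _ _ _ "(*)"] Henstock_Kurzweil_Integration.integral_cong)
  moreover have "cell_dofs x \<tau> = cell_dofs x \<tau>'"
    unfolding cell_dofs_def using assms by (simp cong: Henstock_Kurzweil_Integration.integral_cong)
  ultimately show ?thesis
    using assms vertex_in_cell by (simp add: dofs_def vertex_dofs_def edge_dofs_def)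
qed

text \<open>The coefficients of a field in the nodal basis are its degrees of freedom, so a field whose
  degrees of freedom form a unit vector is a nodal basis function.\<close>

lemma nodal_basis_unique:
  assumes "nodal_basis x \<mu> \<Psi>" "\<tau> \<in> AW x" "dofs x \<mu> \<tau> = axis j 1" "y \<in> cell x"
  shows "\<Psi> j y = \<tau> y"
proof -
  obtain c :: "real^dof" where c: "\<forall>y \<in> cell x. \<tau> y = (\<Sum>i\<in>UNIV. (c $ i) *\<^sub>R \<Psi> i y)"
    using assms(1,2) unfolding nodal_basis_def by blast
  have "axis j 1 = dofs x \<mu> (\<lambda>y. \<Sum>i\<in>UNIV. (c $ i) *\<^sub>R \<Psi> i y)"
    using assms(3) c dofs_cong[of x \<tau>] by auto
  also have "\<dots> = (\<Sum>i\<in>UNIV. (c $ i) *\<^sub>R dofs x \<mu> (\<Psi> i))"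
    using assms(1) by (intro dofs_sum) (auto simp: nodal_basis_def)
  also have "\<dots> = c"
    using assms(1) by (simp add: vec_eq_iff nodal_basis_def if_distrib[of "\<lambda>z. _ * z"] cong: if_cong)
  finally have "c = axis j 1" by simp
  then show ?thesis
    using c assms(4) by (simp add: axis_def if_distrib[of "\<lambda>z. z *\<^sub>R _"] cong: if_cong)
qed

section \<open>The algebra of the Piola map\<close>

lemma invertible_matrix_inv:
  assumes "invertible A"
  shows "A ** matrix_inv A = mat 1" "matrix_inv A ** A = mat 1"
  using someI_ex[OF assms[unfolded invertible_def]] by (auto simp: matrix_inv_def)

lemma invertible_scaleR:
  fixes A :: "real^'n^'n"
  assumes "c \<noteq> 0" "invertible A"
  shows "invertible (c *\<^sub>R A)"
proof -
  have "(c *\<^sub>R A) ** ((1 / c) *\<^sub>R matrix_inv A) = mat 1" 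
    using invertible_matrix_inv(1)[OF assms(2)] assms(1)
    by (simp add: matrix_scaleR_vector_ac scalar_matrix_assoc matrix_scalar_ac)
  then show ?thesis
    using matrix_left_right_inverse unfolding invertible_def by blast
qed

text \<open>\<open>W_tilde J\<close> is the congruence \<open>M \<mapsto> J M J\<^sup>T\<close> on symmetric matrices in the
  coordinates \<open>sym_vec\<close>, hence multiplicative in \<open>J\<close>. Invertibility follows without computing
  a determinant.\<close>

lemma W_tilde_mult: "W_tilde A ** W_tilde B = W_tilde (A ** B)"
  by (simp add: W_tilde_def vec_eq_iff forall_3 matrix_matrix_mult_def sum_3 sum_2)
     (simp add: power2_eq_square algebra_simps)

lemma W_tilde_mat_1: "W_tilde (mat 1) = mat 1"
  by (simp add: W_tilde_def vec_eq_iff forall_3 mat_def)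

lemma invertible_W_tilde:
  assumes "invertible J"
  shows "invertible (W_tilde J)"
  using W_tilde_mult[of J "matrix_inv J"] W_tilde_mult[of "matrix_inv J" J]
    invertible_matrix_inv[OF assms] by (auto simp: invertible_def W_tilde_mat_1)

definition piola_mat :: "real^2^2 \<Rightarrow> real^2^2 \<Rightarrow> real^2^2" where
  "piola_mat J M = (1 / (det J)\<^sup>2) *\<^sub>R (J ** M ** transpose J)"

lemma piola_mat_entry:
  "piola_mat J M $ i $ j = (\<Sum>k\<in>UNIV. \<Sum>l\<in>UNIV. (J $ i $ k * J $ j $ l / (det J)\<^sup>2) * M $ k $ l)"
  by (simp add: piola_mat_def matrix_matrix_mult_def transpose_def sum_2 add_divide_distrib algebra_simps)

lemma sym_vec_piola_mat:
  assumes "M $ 2 $ 1 = M $ 1 $ 2"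
  shows "sym_vec (piola_mat J M) = W_breve J *v sym_vec M"
  using assms
  by (simp add: sym_vec_def vec_eq_iff forall_3 piola_mat_entry sum_2 W_breve_def W_tilde_def
      matrix_vector_mult_def sum_3) (simp add: power2_eq_square add_divide_distrib algebra_simps)

lemma inner_piola_mat:
  "n \<bullet> (piola_mat J M *v s) = 1 / (det J)\<^sup>2 * ((transpose J *v n) \<bullet> (M *v (transpose J *v s)))"
  by (simp add: piola_mat_def scaleR_matrix_vector_assoc[symmetric] matrix_vector_mul_assoc[symmetric]
      dot_lmul_matrix transpose_matrix_vector)

text \<open>In the plane \<open>J\<^sup>T R J = (det J) R\<close>, because skew-symmetric matrices are multiples of \<open>R\<close>. Hence
  normals stay normals under pullback by \<open>J\<^sup>T\<close>, and the signed factor \<open>det J\<close> makes a case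
  distinction on the orientation unnecessary.\<close>

lemma transpose_rot_mult: "transpose J *v (rot *v (J *v e)) = det J *\<^sub>R (rot *v e)"
  by (simp add: vec_eq_iff forall_2 matrix_vector_mult_def sum_2 rot_def transpose_def det_2 algebra_simps)

text \<open>The double Piola map intertwines the row-wise divergence with the vector map
  \<open>v \<mapsto> J v / (det J)\<^sup>2\<close>: in the chain rule the right factor \<open>J\<^sup>T\<close> meets the Jacobian \<open>A\<close> of the
  inverse map and cancels against it. So a divergence of degree at most 1 stays of degree at most 1.\<close>

lemma row_div_piola_mat:
  assumes p: "AW_poly p" and inv: "A ** J = mat 1"
  shows "row_div (\<lambda>y. piola_mat J (p (A *v y + c))) y $ i
    = (\<Sum>k\<in>UNIV. (J $ i $ k / (det J)\<^sup>2) * row_div p (A *v y + c) $ k)"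
proof -
  define D where "D k l = frechet_derivative (\<lambda>z. p z $ k $ l) (at (A *v y + c))" for k l
  have D: "((\<lambda>z. p z $ k $ l) has_derivative D k l) (at (A *v y + c))" for k l
    unfolding D_def using AW_poly_entry_differentiable[OF p] by (simp flip: frechet_derivative_works)
  then have linD: "linear (D k l)" for k l
    by (rule has_derivative_linear)
  have g: "((\<lambda>z. A *v z + c) has_derivative (\<lambda>h. A *v h)) (at y)"
    using bounded_linear_imp_has_derivative[OF matrix_vector_mul_bounded_linear[of A]]
    by (intro has_derivative_add_const)
  have "((\<lambda>z. p (A *v z + c) $ k $ l) has_derivative (\<lambda>h. D k l (A *v h))) (at y)" for k l
    using has_derivative_compose[OF g D[of k l]] .
  then have deriv: "((\<lambda>z. piola_mat J (p (A *v z + c)) $ i $ j) has_derivative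
      (\<lambda>h. \<Sum>k\<in>UNIV. \<Sum>l\<in>UNIV. (J $ i $ k * J $ j $ l / (det J)\<^sup>2) * D k l (A *v h))) (at y)" for j
    unfolding piola_mat_entry by (intro has_derivative_sum has_derivative_mult_right)
  then have fd: "frechet_derivative (\<lambda>z. piola_mat J (p (A *v z + c)) $ i $ j) (at y) =
      (\<lambda>h. \<Sum>k\<in>UNIV. \<Sum>l\<in>UNIV. (J $ i $ k * J $ j $ l / (det J)\<^sup>2) * D k l (A *v h))" for j
    by (intro frechet_derivative_at[symmetric])
  \<comment> \<open>The cancellation: the coefficient of the \<open>l\<close>-th partial derivative sums to \<open>A J e\<^sub>l = e\<^sub>l\<close>.\<close>
  have "(\<Sum>j\<in>UNIV. J $ j $ l *\<^sub>R (A *v axis j 1)) = axis l 1" for l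
  proof -
    have "(\<Sum>j\<in>UNIV. J $ j $ l *\<^sub>R (A *v axis j 1)) = A *v (J *v axis l 1)"
      unfolding matrix_vector_mult_basis column_def
      by (simp add: vec_eq_iff matrix_vector_mult_def sum_2 algebra_simps)
    then show ?thesis
      by (simp add: matrix_vector_mul_assoc inv)
  qed
  then have "(\<Sum>j\<in>UNIV. J $ j $ l * D k l (A *v axis j 1)) = D k l (axis l 1)" for k l
    using linear_sum[OF linD[of k l], of "\<lambda>j. J $ j $ l *\<^sub>R (A *v axis j 1)" UNIV]
      linear_scale[OF linD[of k l]] by simp
  then have *: "J $ 1 $ l * D k l (A *v axis 1 1) + J $ 2 $ l * D k l (A *v axis 2 1) = D k l (axis l 1)" for k l
    by (simp add: sum_2)
  have "row_div (\<lambda>y. piola_mat J (p (A *v y + c))) y $ i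
      = (\<Sum>k\<in>UNIV. \<Sum>l\<in>UNIV. (J $ i $ k / (det J)\<^sup>2) *
          (J $ 1 $ l * D k l (A *v axis 1 1) + J $ 2 $ l * D k l (A *v axis 2 1)))"
    unfolding row_div_def vec_lambda_beta fd
    by (simp add: sum_2 algebra_simps)
  then show ?thesis
    unfolding * by (simp add: row_div_def sum_distrib_left D_def)
qed

lemma AW_poly_piola_mat:
  assumes p: "AW_poly p" and inv: "A ** J = mat 1"
  shows "AW_poly (\<lambda>y. piola_mat J (p (A *v y + c)))"
  unfolding AW_poly_def
proof (intro conjI allI)
  fix y
  have "p z $ 2 $ 1 = p z $ 1 $ 2" for z
    using p unfolding AW_poly_def by (auto simp: vec_eq_iff transpose_def)
  then show "transpose (piola_mat J (p (A *v y + c))) = piola_mat J (p (A *v y + c))"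
    by (simp add: vec_eq_iff forall_2 transpose_def piola_mat_entry sum_2 algebra_simps)
next
  fix i j
  show "poly_deg_le 3 (\<lambda>y. piola_mat J (p (A *v y + c)) $ i $ j)"
    using p unfolding piola_mat_entry AW_poly_def
    by (intro poly_deg_le_sum poly_deg_le_cmul poly_deg_le_compose_affine) auto
next
  fix i
  show "poly_deg_le 1 (\<lambda>y. row_div (\<lambda>y. piola_mat J (p (A *v y + c))) y $ i)"
    using p unfolding row_div_piola_mat[OF p inv] AW_poly_def
    by (intro poly_deg_le_sum poly_deg_le_cmul poly_deg_le_compose_affine) auto
qed

section \<open>Nondegenerate triangles and edge frames\<close>

definition cross2 :: "real^2 \<Rightarrow> real^2 \<Rightarrow> real" where
  "cross2 u v = u $ 1 * v $ 2 - u $ 2 * v $ 1"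

lemma nondegenerate_cross2:
  assumes "nondegenerate x"
  shows "cross2 (x 1 - x 2) (x 3 - x 2) \<noteq> 0"
proof
  assume "cross2 (x 1 - x 2) (x 3 - x 2) = 0"
  moreover define u v where "u = x 1 - x 2" and "v = x 3 - x 2"
  ultimately have eq: "u $ 1 * v $ 2 = u $ 2 * v $ 1"
    by (simp add: cross2_def)
  have "u = 0 \<or> (\<exists>c. v = c *\<^sub>R u)"
  proof (cases "u $ 1 = 0")
    case True
    then show ?thesis
      using eq by (cases "u $ 2 = 0")
        (auto simp: vec_eq_iff forall_2 intro!: exI[of _ "v $ 2 / u $ 2"])
  next
    case False
    then show ?thesis
      using eq by (auto simp: vec_eq_iff forall_2 field_simps intro!: exI[of _ "v $ 1 / u $ 1"])
  qed
  then have "collinear {x 1, x 2, x 3}"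
    by (subst collinear_3) (auto simp: collinear_lemma u_def v_def)
  then show False
    using assms by (simp add: nondegenerate_def)
qed

lemma cross2_mult: "cross2 (J *v u) (J *v v) = det J * cross2 u v"
  by (simp add: cross2_def matrix_vector_mult_def sum_2 det_2 algebra_simps)

lemma nondegenerate_edge_vec:
  assumes "nondegenerate x"
  shows "edge_vec x k \<noteq> 0"
proof -
  have "k \<in> {1, 2, 3}" using UNIV_3 by blast
  then show ?thesis
    using assms unfolding nondegenerate_def edge_vec_def edge_lo_def edge_hi_def
    by (auto simp: insert_commute)
qed

lemma edge_frame_expansion:
  assumes "edge_vec x k \<noteq> 0"
  shows "v = (edge_normal x k \<bullet> v) *\<^sub>R edge_normal x k + (edge_tangent x k \<bullet> v) *\<^sub>R edge_tangent x k"
proof -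
  define t where "t = edge_tangent x k"
  have "norm t = 1" using assms by (simp add: t_def edge_tangent_def)
  then have t: "t $ 1 * t $ 1 + t $ 2 * t $ 2 = 1"
    by (simp add: norm_eq_1 inner_vec_def sum_2)
  have n: "edge_normal x k $ 1 = t $ 2" "edge_normal x k $ 2 = - t $ 1"
    by (simp_all add: t_def edge_normal_def rot_def matrix_vector_mult_def sum_2)
  have "v $ 1 = (t $ 1 * t $ 1 + t $ 2 * t $ 2) * v $ 1" "v $ 2 = (t $ 1 * t $ 1 + t $ 2 * t $ 2) * v $ 2"
    unfolding t by simp_all
  then show ?thesis
    unfolding t_def[symmetric] vec_eq_iff forall_2
    by (simp add: n inner_vec_def sum_2 algebra_simps)
qed

section \<open>Degrees of freedom under the affine map\<close>

locale affine_triangle_map =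
  fixes xh x :: "3 \<Rightarrow> real^2" and F :: "real^2 \<Rightarrow> real^2" and J :: "real^2^2" and b :: "real^2"
  assumes nondeg: "nondegenerate xh" "nondegenerate x"
    and affine: "\<And>y. y \<in> cell xh \<Longrightarrow> F y = J *v y + b"
    and bij: "bij_betw F (cell xh) (cell x)"
    and vertices: "\<And>i. F (xh i) = x i"
begin

lemma vertex_image: "x i = J *v xh i + b"
  using vertices affine vertex_in_cell by metis

lemma vertex_diff: "x i - x j = J *v (xh i - xh j)"
  by (simp add: vertex_image matrix_vector_mult_diff_distrib)

text \<open>\<open>J\<close> multiplies the signed area of the triangle by \<open>det J\<close>, and the image triangle has nonzero
  area.\<close>

lemma det_J: "det J \<noteq> 0"
  using nondegenerate_cross2[OF nondeg(2)] unfolding vertex_diff cross2_mult by auto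

lemma invertible_J: "invertible J"
  using det_J by (simp add: invertible_det_nz)

lemma edge_vec_image: "edge_vec x k = J *v edge_vec xh k"
  unfolding edge_vec_def by (rule vertex_diff)

abbreviation "ratio k \<equiv> norm (edge_vec xh k) / norm (edge_vec x k)"

lemma edge_vec_nz: "edge_vec xh k \<noteq> 0" "edge_vec x k \<noteq> 0"
  using nondeg nondegenerate_edge_vec by auto

lemma edge_tangent_image: "edge_tangent x k = ratio k *\<^sub>R (J *v edge_tangent xh k)"
  using edge_vec_nz[of k]
  by (simp add: edge_tangent_def edge_vec_image matrix_vector_mult_scaleR field_simps)

text \<open>For a normal, \<open>J\<^sup>T n\<close> has no tangential component, whereas \<open>J\<^sup>T t\<close> in general has both; \<open>edge_coeffs\<close>
  are, up to scaling, the components of the latter. This asymmetry is the triangular shape of the edge block.\<close>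

lemma normal_pullback:
  "transpose J *v edge_normal x k = (det J * ratio k) *\<^sub>R edge_normal xh k"
  by (simp add: edge_normal_def edge_tangent_image matrix_vector_mult_scaleR transpose_rot_mult mult.commute
      del: transpose_matrix_vector)

lemma tangent_pullback:
  "transpose J *v edge_tangent x k = (det J * ratio k) *\<^sub>R
     (edge_coeffs xh J k $ 1 *\<^sub>R edge_normal xh k + edge_coeffs xh J k $ 2 *\<^sub>R edge_tangent xh k)"
proof -
  define v where "v = transpose J *v (J *v edge_tangent xh k)"
  have c: "edge_coeffs xh J k $ 1 = edge_normal xh k \<bullet> v / det J"
    "edge_coeffs xh J k $ 2 = edge_tangent xh k \<bullet> v / det J"
    by (simp_all add: edge_coeffs_def v_def matrix_vector_mul_assoc[symmetric])
       (simp_all add: matrix_vector_mult_def[of "vector [_, _]"] inner_vec_def)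
  have "transpose J *v edge_tangent x k = ratio k *\<^sub>R v"
    by (simp add: edge_tangent_image matrix_vector_mult_scaleR v_def)
  also have "\<dots> = ratio k *\<^sub>R ((edge_normal xh k \<bullet> v) *\<^sub>R edge_normal xh k + (edge_tangent xh k \<bullet> v) *\<^sub>R edge_tangent xh k)"
    using edge_frame_expansion[OF edge_vec_nz(1), of v k] by simp
  finally show ?thesis
    using det_J by (simp add: c scaleR_add_right)
qed

text \<open>The coefficient equals \<open>\<parallel>J t\<parallel>\<^sup>2 / det J\<close> for the reference tangent \<open>t\<close>.\<close>

lemma edge_coeff_nz: "edge_coeffs xh J k $ 2 \<noteq> 0"
proof -
  have "edge_coeffs xh J k $ 2 = edge_tangent xh k \<bullet> (transpose J *v (J *v edge_tangent xh k)) / det J"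
    by (simp add: edge_coeffs_def matrix_vector_mul_assoc[symmetric])
       (simp add: matrix_vector_mult_def[of "vector [_, _]"] inner_vec_def)
  also have "\<dots> = (J *v edge_tangent xh k) \<bullet> (J *v edge_tangent xh k) / det J"
    by (metis dot_lmul_matrix transpose_matrix_vector inner_commute)
  moreover have "J *v edge_tangent xh k \<noteq> 0"
    using edge_vec_nz[of k] by (auto simp: edge_tangent_def matrix_vector_mult_scaleR edge_vec_image)
  ultimately show ?thesis
    using det_J by simp
qed

lemma invertible_W_edge: "invertible (W_edge xh x J k)"
proof -
  define \<alpha> \<beta> where "\<alpha> = edge_coeffs xh J k $ 1" and "\<beta> = edge_coeffs xh J k $ 2"
  have \<beta>: "\<beta> \<noteq> 0" using edge_coeff_nz by (simp add: \<beta>_def)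
  let ?A = "vector [vector [1, 0, 0, 0], vector [\<alpha>, \<beta>, 0, 0], vector [0, 0, 1, 0], vector [0, 0, \<alpha>, \<beta>]] :: real^4^4"
  let ?B = "vector [vector [1, 0, 0, 0], vector [-\<alpha>/\<beta>, 1/\<beta>, 0, 0], vector [0, 0, 1, 0], vector [0, 0, -\<alpha>/\<beta>, 1/\<beta>]] :: real^4^4"
  have "?A ** ?B = mat 1"
    using \<beta> by (simp add: vec_eq_iff forall_4 matrix_matrix_mult_def sum_4 mat_def vector_def)
  then have "invertible ?A"
    using matrix_left_right_inverse unfolding invertible_def by blast
  moreover have "W_edge xh x J k = ratio k *\<^sub>R ?A"
    by (simp add: W_edge_def Let_def \<alpha>_def \<beta>_def)
  moreover have "ratio k \<noteq> 0" using edge_vec_nz by simp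
  ultimately show ?thesis
    using invertible_scaleR by metis
qed

abbreviation "Piola \<equiv> piola (cell xh) F J"

lemma piola_image: "z \<in> cell xh \<Longrightarrow> Piola \<tau> (J *v z + b) = piola_mat J (\<tau> z)"
  using bij affine by (metis bij_betw_def inv_into_f_f piola_def piola_mat_def)

lemma cell_image: "(\<lambda>z. J *v z + b) ` cell xh = cell x"
  using bij affine by (auto simp: bij_betw_def image_iff) 

text \<open>The polynomial representing the field on the reference cell is transported by the globally
  defined inverse affine map, which agrees with the inverse of \<open>F\<close> on the triangle.\<close>

lemma piola_AW:
  assumes "\<tau> \<in> AW xh"
  shows "Piola \<tau> \<in> AW x"
proof -
  obtain p where p: "AW_poly p" "\<And>z. z \<in> cell xh \<Longrightarrow> \<tau> z = p z"
    using assms unfolding AW_iff by blast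
  let ?A = "matrix_inv J"
  note inv = invertible_matrix_inv[OF invertible_J]
  have "Piola \<tau> y = piola_mat J (p (?A *v y + (- (?A *v b))))" if y: "y \<in> cell x" for y
  proof -
    obtain z where z: "z \<in> cell xh" "y = J *v z + b"
      using y unfolding cell_image[symmetric] by blast
    moreover have "?A *v y + (- (?A *v b)) = z"
      by (simp add: z matrix_vector_right_distrib matrix_vector_mul_assoc inv)
    ultimately show ?thesis
      using piola_image p(2) by auto
  qed
  then show ?thesis
    using AW_poly_piola_mat[OF p(1) inv(2)] unfolding AW_iff by blast
qed

lemma vertex_dofs_piola:
  assumes "\<tau> \<in> AW xh"
  shows "vertex_dofs x k (Piola \<tau>) = W_breve J *v vertex_dofs xh k \<tau>"
  unfolding vertex_dofs_sym_vec vertex_image[of k]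
  using vertex_in_cell AW_symmetric[OF assms] by (simp add: piola_image sym_vec_piola_mat)

text \<open>The change of variables contributes \<open>\<bar>det J\<bar>\<close> against \<open>1 / (det J)\<^sup>2\<close> from the Piola map, which leaves
  \<open>sgn (det J) / det J\<close>.\<close>

lemma cell_dofs_piola:
  assumes \<tau>: "\<tau> \<in> AW xh"
  shows "cell_dofs x (Piola \<tau>) = (sgn (det J) *\<^sub>R W_check J) *v cell_dofs xh \<tau>"
proof -
  let ?g = "\<lambda>z. J *v z + b"
  have g: "(?g has_derivative (\<lambda>h. J *v h)) (at z within cell xh)" for z
    using bounded_linear_imp_has_derivative[OF matrix_vector_mul_bounded_linear[of J]]
    by (intro has_derivative_add_const)
  have inj: "inj_on ?g (cell xh)"
    using bij affine by (metis (mono_tags, lifting) bij_betw_def inj_on_cong)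
  have int: "(\<lambda>z. sym_vec (\<tau> z)) integrable_on (cell xh)"
    using sym_vec_integrable[OF \<tau>] by (rule set_lebesgue_integral_eq_integral(1))
  have "cell_dofs x (Piola \<tau>) = integral (?g ` cell xh) (\<lambda>y. sym_vec (Piola \<tau> y))"
    by (simp add: cell_dofs_sym_vec[OF piola_AW[OF \<tau>]] cell_image)
  also have "\<dots> = integral (cell xh) (\<lambda>z. \<bar>det (matrix (\<lambda>h. J *v h))\<bar> *\<^sub>R sym_vec (Piola \<tau> (?g z)))"
    using compact_imp_closed[OF compact_cell] sym_vec_integrable[OF piola_AW[OF \<tau>]]
    by (intro integral_change_of_variables g inj) (auto simp: cell_image)
  also have "\<dots> = integral (cell xh) (\<lambda>z. \<bar>det J\<bar> *\<^sub>R (W_breve J *v sym_vec (\<tau> z)))"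
    using AW_symmetric[OF \<tau>]
    by (intro Henstock_Kurzweil_Integration.integral_cong) (simp add: piola_image sym_vec_piola_mat)
  also have "\<dots> = \<bar>det J\<bar> *\<^sub>R (W_breve J *v cell_dofs xh \<tau>)"
    using integral_linear[OF int matrix_vector_mul_bounded_linear[of "W_breve J"]]
    by (simp add: cell_dofs_sym_vec[OF \<tau>] o_def)
  also have "\<dots> = (sgn (det J) *\<^sub>R W_check J) *v cell_dofs xh \<tau>"
    using det_J by (simp add: W_breve_def W_check_def scaleR_matrix_vector_assoc[symmetric]
        power2_eq_square sgn_real_def abs_real_def)
  finally show ?thesis .
qed

text \<open>The row direction \<open>n\<close> and the test direction \<open>s\<close> each contribute \<open>det J\<close> and a ratio of edge lengths.
  The determinants cancel against the Piola factor, and one of the two ratios is absorbed by the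
  change of arc length. The weight needs no transformation, since \<open>F\<close> matches the parametrizations
  of the two edges.\<close>

lemma edge_moment_piola:
  assumes \<tau>: "\<tau> \<in> AW xh" and s: "transpose J *v s = (det J * ratio k) *\<^sub>R (c *\<^sub>R edge_normal xh k + d *\<^sub>R edge_tangent xh k)"
  shows "edge_moment x k s m (Piola \<tau>) =
    ratio k * (c * edge_moment xh k (edge_normal xh k) m \<tau> + d * edge_moment xh k (edge_tangent xh k) m \<tau>)"
proof -
  let ?\<gamma> = "linepath (x (edge_lo k)) (x (edge_hi k))"
  let ?\<gamma>h = "linepath (xh (edge_lo k)) (xh (edge_hi k))"
  let ?s = "c *\<^sub>R edge_normal xh k + d *\<^sub>R edge_tangent xh k"
  have \<gamma>: "?\<gamma> r = J *v ?\<gamma>h r + b" for r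
    by (simp add: linepath_def vertex_image matrix_vector_right_distrib matrix_vector_mult_scaleR algebra_simps)
  have "edge_normal x k \<bullet> (Piola \<tau> (?\<gamma> r) *v s) = (ratio k)\<^sup>2 * (edge_normal xh k \<bullet> (\<tau> (?\<gamma>h r) *v ?s))"
    if "r \<in> {0..1}" for r
    unfolding \<gamma> piola_image[OF edge_point_in_cell[OF that]] inner_piola_mat normal_pullback s
    using det_J by (simp add: matrix_vector_mult_scaleR power2_eq_square)
  then have "integral {0..1} (\<lambda>r. (edge_normal x k \<bullet> (Piola \<tau> (?\<gamma> r) *v s)) * poly m r) =
      integral {0..1} (\<lambda>r. (ratio k)\<^sup>2 * ((edge_normal xh k \<bullet> (\<tau> (?\<gamma>h r) *v ?s)) * poly m r))"
    by (intro Henstock_Kurzweil_Integration.integral_cong) (simp only: mult.assoc)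
  then have "edge_moment x k s m (Piola \<tau>) = norm (edge_vec x k) *
      integral {0..1} (\<lambda>r. (ratio k)\<^sup>2 * ((edge_normal xh k \<bullet> (\<tau> (?\<gamma>h r) *v ?s)) * poly m r))"
    unfolding edge_moment_def by (simp only:)
  also have "\<dots> = ratio k * edge_moment xh k ?s m \<tau>"
    using edge_vec_nz[of k] by (simp add: edge_moment_def power2_eq_square)
  finally show ?thesis
    unfolding edge_moment_lincomb[OF \<tau>] .
qed

lemma edge_dofs_piola:
  assumes \<tau>: "\<tau> \<in> AW xh"
  shows "edge_dofs x \<mu> k (Piola \<tau>) = W_edge xh x J k *v edge_dofs xh \<mu> k \<tau>"
proof -
  have "transpose J *v edge_normal x k = (det J * ratio k) *\<^sub>R (1 *\<^sub>R edge_normal xh k + 0 *\<^sub>R edge_tangent xh k)"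
    by (simp add: normal_pullback del: transpose_matrix_vector)
  note n = edge_moment_piola[OF \<tau> this] and t = edge_moment_piola[OF \<tau> tangent_pullback]
  show ?thesis
    unfolding edge_dofs_def n t W_edge_def Let_def
    by (simp add: vec_eq_iff forall_4 matrix_vector_mult_def sum_4 vector_def algebra_simps)
qed

lemma dofs_piola:
  assumes "\<tau> \<in> AW xh"
  shows "dofs x \<mu> (Piola \<tau>) = block_diag (\<lambda>k. W_breve J) (W_edge xh x J) (sgn (det J) *\<^sub>R W_check J) *v dofs xh \<mu> \<tau>"
  unfolding dofs_def block_diag_mult_block_vec
  by (simp add: vertex_dofs_piola edge_dofs_piola cell_dofs_piola assms)

lemma invertible_blocks:
  "invertible (W_breve J)" "invertible (sgn (det J) *\<^sub>R W_check J)"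
  using det_J invertible_W_tilde[OF invertible_J]
  by (auto simp: W_breve_def W_check_def sgn_zero_iff simp del: scaleR_scaleR intro!: invertible_scaleR)

end

theorem mainTheorem3:
  fixes xh x :: "3 \<Rightarrow> real^2"
    and F :: "real^2 \<Rightarrow> real^2" and J :: "real^2^2" and b :: "real^2"
    and \<mu> :: "real poly"
  assumes nondeg: "nondegenerate xh" "nondegenerate x"
    and affine: "\<And>y. y \<in> cell xh \<Longrightarrow> F y = J *v y + b"
    and bij: "bij_betw F (cell xh) (cell x)"
    and vertices: "\<And>i. F (xh i) = x i"
    and basis: "completes_P1_basis \<mu>"
  shows
    "let Piola = piola (cell xh) F J;
         D = block_diag (\<lambda>k. W_breve J) (W_edge xh x J) (sgn (det J) *\<^sub>R W_check J);
         P = block_diag (\<lambda>k. matrix_inv (W_breve J)) (\<lambda>k. matrix_inv (W_edge xh x J k))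
               (matrix_inv (sgn (det J) *\<^sub>R W_check J))
     in (\<forall>\<tau> \<in> AW xh. Piola \<tau> \<in> AW x)
      \<and> (\<forall>\<tau> \<in> AW xh. dofs x \<mu> (Piola \<tau>) = D *v dofs xh \<mu> \<tau>)
      \<and> D ** P = mat 1 \<and> P ** D = mat 1
      \<and> (\<forall>\<tau> \<in> AW xh. dofs xh \<mu> \<tau> = P *v dofs x \<mu> (Piola \<tau>))
      \<and> (\<forall>\<Psi>h \<Psi>. nodal_basis xh \<mu> \<Psi>h \<longrightarrow> nodal_basis x \<mu> \<Psi> \<longrightarrow>
           (\<forall>j. \<forall>y \<in> cell x.
              \<Psi> j y = (\<Sum>i\<in>UNIV. (transpose P $ j $ i) *\<^sub>R Piola (\<Psi>h i) y)))"
proof -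
  interpret affine_triangle_map xh x F J b
    using nondeg affine bij vertices by unfold_locales
  define D where "D = block_diag (\<lambda>k. W_breve J) (W_edge xh x J) (sgn (det J) *\<^sub>R W_check J)"
  define P where "P = block_diag (\<lambda>k. matrix_inv (W_breve J)) (\<lambda>k. matrix_inv (W_edge xh x J k))
      (matrix_inv (sgn (det J) *\<^sub>R W_check J))"
  have DP: "D ** P = mat 1" and PD: "P ** D = mat 1"
    unfolding D_def P_def block_diag_mult
    by (simp_all add: invertible_matrix_inv invertible_blocks invertible_W_edge block_diag_mat_1)
  have dofs: "dofs x \<mu> (Piola \<tau>) = D *v dofs xh \<mu> \<tau>" if "\<tau> \<in> AW xh" for \<tau>
    using dofs_piola[OF that] by (simp add: D_def)
  have nodal: "\<Psi> j y = (\<Sum>i\<in>UNIV. (transpose P $ j $ i) *\<^sub>R Piola (\<Psi>h i) y)"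
    if h: "nodal_basis xh \<mu> \<Psi>h" and \<Psi>: "nodal_basis x \<mu> \<Psi>" and y: "y \<in> cell x" for \<Psi>h \<Psi> j y
  proof (rule nodal_basis_unique[OF \<Psi> _ _ y])
    have AWh: "\<Psi>h i \<in> AW xh" and dual: "dofs xh \<mu> (\<Psi>h i) = axis i 1" for i
      using h by (auto simp: nodal_basis_def vec_eq_iff axis_def)
    show "(\<lambda>y. \<Sum>i\<in>UNIV. (transpose P $ j $ i) *\<^sub>R Piola (\<Psi>h i) y) \<in> AW x"
      by (intro AW_sum piola_AW AWh)
    have "dofs x \<mu> (\<lambda>y. \<Sum>i\<in>UNIV. (transpose P $ j $ i) *\<^sub>R Piola (\<Psi>h i) y)
        = (\<Sum>i\<in>UNIV. (transpose P $ j $ i) *\<^sub>R (D *v axis i 1))"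
      using AWh piola_AW by (subst dofs_sum) (simp_all add: dofs dual)
    \<comment> \<open>Row \<open>j\<close> of \<open>P\<^sup>T\<close> is column \<open>j\<close> of \<open>P\<close>.\<close>
    also have "\<dots> = D *v (P *v axis j 1)"
      by (simp add: vec_eq_iff matrix_vector_mult_basis column_def transpose_def
          matrix_vector_mult_def[of D "\<chi> i. P $ i $ j"] mult.commute)
    also have "\<dots> = axis j 1"
      by (simp add: matrix_vector_mul_assoc DP)
    finally show "dofs x \<mu> (\<lambda>y. \<Sum>i\<in>UNIV. (transpose P $ j $ i) *\<^sub>R Piola (\<Psi>h i) y) = axis j 1" .
  qed
  show ?thesis
    unfolding Let_def D_def[symmetric] P_def[symmetric]
    using piola_AW dofs DP PD nodal by (auto simp: matrix_vector_mul_assoc)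
qed

end
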